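(* Let $n\ge 1$, let $\Gamma:\mathbb R^n\times\mathbb R^n\to\mathbb R^n$ be a symmetric bilinear map and let $\nabla$ be the symmetric connection on $\mathbb R^n$ given by $\nabla_XY=\mathrm dY(X)+\Gamma(X,Y)$ for smooth vector fields $X,Y$ on $\mathbb R^n$. Let $g_0$ be a nondegenerate symmetric bilinear form on $T_0\mathbb R^n\cong\mathbb R^n$. Then $g_0$ extends to a semi-Riemannian metric $g$ on $\mathbb R^n$ having $\nabla$ as its Levi-Civita connection if and only if the linear operator $$\exp\big(\Gamma(v)\big)\,[\Gamma(w_1),\Gamma(w_2)]\,\exp\big(-\Gamma(v)\big):\mathbb R^n\to\mathbb R^n$$ is anti-symmetric with respect to $g_0$, for all $v,w_1,w_2\in\mathbb R^n$.
   Context: For $v\in\mathbb R^n$, $\Gamma(v)$ denotes the linear endomorphism $\Gamma(v,\cdot)$ of $\mathbb R^n$; $[A,B]=AB-BA$ for linear endomorphisms $A,B$. A linear operator $A$ is anti-symmetric with respect to $g_0$ if $g_0(A\xi,\eta)+g_0(\xi,A\eta)=0$ for all $\xi,\eta$. A semi-Riemannian metric is a smooth, globally defined, symmetric bilinear form field on the tangent spaces that is nondegenerate at each point (no definiteness required). "$g_0$ extends to $g$" means that the value of $g$ at the origin is $g_0$. A symmetric (torsion-free) connection $\nabla$ is the Levi-Civita connection of $g$ when $\nabla g=0$. *)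

theory Defs
  imports "HOL-Analysis.Analysis"
begin

text \<open>All tangent spaces of \<open>real ^ 'n\<close> are identified with \<open>real ^ 'n\<close>. Vector fields are functions
  \<open>real ^ 'n \<Rightarrow> real ^ 'n\<close>; a field of bilinear forms is a function of the base point followed by the
  two vector arguments.\<close>

type_synonym 'n vfield = "real ^ 'n \<Rightarrow> real ^ 'n"
type_synonym 'n form_field = "real ^ 'n \<Rightarrow> real ^ 'n \<Rightarrow> real ^ 'n \<Rightarrow> real"

text \<open>On a finite-dimensional domain, continuity of the total derivative is the same as continuity
  of each directional derivative \<open>\<lambda>x. frechet_derivative f (at x) v\<close>, so the recursion below gives
  the usual notion of a \<open>k\<close> times continuously differentiable map.\<close>

primrec times_cont_diff :: "nat \<Rightarrow> ('a::euclidean_space \<Rightarrow> 'b::euclidean_space) \<Rightarrow> bool" where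
  "times_cont_diff 0 f \<longleftrightarrow> continuous_on UNIV f"
| "times_cont_diff (Suc k) f \<longleftrightarrow>
     (\<forall>x. f differentiable (at x)) \<and>
     (\<forall>v. times_cont_diff k (\<lambda>x. frechet_derivative f (at x) v))"

definition smooth :: "('a::euclidean_space \<Rightarrow> 'b::euclidean_space) \<Rightarrow> bool" where
  "smooth f \<longleftrightarrow> (\<forall>k. times_cont_diff k f)"

definition symmetric_map :: "('a \<Rightarrow> 'a \<Rightarrow> 'b) \<Rightarrow> bool" where
  "symmetric_map B \<longleftrightarrow> (\<forall>u v. B u v = B v u)"

definition nondegenerate_form :: "('a::real_vector \<Rightarrow> 'a \<Rightarrow> real) \<Rightarrow> bool" where
  "nondegenerate_form B \<longleftrightarrow> (\<forall>u. (\<forall>v. B u v = 0) \<longrightarrow> u = 0)"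

definition antisymmetric_wrt :: "('a::real_vector \<Rightarrow> 'a \<Rightarrow> real) \<Rightarrow> ('a \<Rightarrow> 'a) \<Rightarrow> bool" where
  "antisymmetric_wrt B A \<longleftrightarrow> (\<forall>\<xi> \<eta>. B (A \<xi>) \<eta> + B \<xi> (A \<eta>) = 0)"

definition semi_riemannian_metric :: "'n::finite form_field \<Rightarrow> bool" where
  "semi_riemannian_metric g \<longleftrightarrow>
     (\<forall>x. bilinear (g x) \<and> symmetric_map (g x) \<and> nondegenerate_form (g x)) \<and>
     (\<forall>u v. smooth (\<lambda>x. g x u v))"

definition connection_of ::
    "(real ^ 'n \<Rightarrow> real ^ 'n \<Rightarrow> real ^ 'n) \<Rightarrow> 'n::finite vfield \<Rightarrow> 'n vfield \<Rightarrow> 'n vfield" where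
  "connection_of \<Gamma> X Y = (\<lambda>x. frechet_derivative Y (at x) (X x) + \<Gamma> (X x) (Y x))"

definition lie_bracket :: "'n::finite vfield \<Rightarrow> 'n vfield \<Rightarrow> 'n vfield" where
  "lie_bracket X Y =
     (\<lambda>x. frechet_derivative Y (at x) (X x) - frechet_derivative X (at x) (Y x))"

definition torsion_free :: "('n::finite vfield \<Rightarrow> 'n vfield \<Rightarrow> 'n vfield) \<Rightarrow> bool" where
  "torsion_free D \<longleftrightarrow>
     (\<forall>X Y. smooth X \<longrightarrow> smooth Y \<longrightarrow> (\<forall>x. D X Y x - D Y X x = lie_bracket X Y x))"

text \<open>The function \<open>(\<nabla>\<^sub>X g)(Y, Z) = X(g(Y, Z)) - g(\<nabla>\<^sub>X Y, Z) - g(Y, \<nabla>\<^sub>X Z)\<close>.\<close>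

definition cov_deriv_form ::
    "('n::finite vfield \<Rightarrow> 'n vfield \<Rightarrow> 'n vfield) \<Rightarrow> 'n form_field \<Rightarrow>
     'n vfield \<Rightarrow> 'n vfield \<Rightarrow> 'n vfield \<Rightarrow> real ^ 'n \<Rightarrow> real" where
  "cov_deriv_form D g X Y Z =
     (\<lambda>x. frechet_derivative (\<lambda>y. g y (Y y) (Z y)) (at x) (X x)
          - g x (D X Y x) (Z x) - g x (Y x) (D X Z x))"

definition levi_civita_connection ::
    "'n::finite form_field \<Rightarrow> ('n vfield \<Rightarrow> 'n vfield \<Rightarrow> 'n vfield) \<Rightarrow> bool" where
  "levi_civita_connection g D \<longleftrightarrow>
     torsion_free D \<and>
     (\<forall>X Y Z. smooth X \<longrightarrow> smooth Y \<longrightarrow> smooth Z \<longrightarrow> (\<forall>x. cov_deriv_form D g X Y Z x = 0))"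

text \<open>Linear endomorphisms are functions satisfying \<^const>\<open>linear\<close>, which have no \<^const>\<open>exp\<close> of
  their own; the exponential series is therefore taken pointwise. By the lemma after it, the series
  converges absolutely for every linear operator on a Euclidean space.\<close>

definition operator_exp :: "('a::euclidean_space \<Rightarrow> 'a) \<Rightarrow> 'a \<Rightarrow> 'a" where
  "operator_exp A = (\<lambda>x. \<Sum>k. (1 / fact k) *\<^sub>R (A ^^ k) x)"

lemma summable_operator_exp:
  fixes A :: "'a::euclidean_space \<Rightarrow> 'a"
  assumes "linear A"
  shows "summable (\<lambda>k. norm ((1 / fact k) *\<^sub>R (A ^^ k) x))"
proof -
  obtain K where K: "K > 0" "\<And>x. norm (A x) \<le> K * norm x"
    using linear_bounded_pos[OF assms] by blast
  have le: "norm ((A ^^ k) x) \<le> K ^ k * norm x" for k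
  proof (induction k)
    case (Suc k)
    have "norm ((A ^^ Suc k) x) \<le> K * norm ((A ^^ k) x)"
      using K(2) by simp
    also have "\<dots> \<le> K * (K ^ k * norm x)"
      using Suc K(1) by (intro mult_left_mono) auto
    finally show ?case by (simp add: mult.assoc)
  qed simp
  have "summable (\<lambda>k. inverse (fact k) * K ^ k * norm x)"
    by (intro summable_mult2 summable_exp)
  then show ?thesis
  proof (rule summable_comparison_test')
    show "norm (norm ((1 / fact k) *\<^sub>R (A ^^ k) x)) \<le> inverse (fact k) * K ^ k * norm x" for k
      using mult_left_mono[OF le[of k], of "inverse (fact k)"] by (simp add: divide_inverse mult.assoc)
  qed
qed

definition commutator :: "('a::real_vector \<Rightarrow> 'a) \<Rightarrow> ('a \<Rightarrow> 'a) \<Rightarrow> 'a \<Rightarrow> 'a" where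
  "commutator A B = (\<lambda>x. A (B x) - B (A x))"

end

theory Submission
  imports Defs
begin

text \<open>A form field \<open>G\<close> satisfies \<open>\<nabla>G = 0\<close> iff its derivative in direction \<open>w\<close> is
  \<open>G (\<Gamma> w a) b + G a (\<Gamma> w b)\<close> for constant \<open>a\<close>, \<open>b\<close>; the Leibniz rule covers arbitrary vector fields
  (\<open>levi_civita_iff_parallel\<close>). Restricted to a ray through the origin this is a linear ordinary
  differential equation, which leaves one candidate for the metric with value \<open>g\<^sub>0\<close> at the origin,
  the form \<open>g\<^sub>0 (exp (\<Gamma> x) a) (exp (\<Gamma> x) b)\<close> (\<open>parallel_form_eq_transported_form\<close>).

  Because \<open>\<Gamma>\<close> is constant in the base point, the curvature of \<open>\<nabla>\<close> is \<open>[\<Gamma> w\<^sub>1, \<Gamma> w\<^sub>2]\<close>. The curvature of a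
  connection with a parallel form is antisymmetric with respect to that form at every point: this
  is the symmetry of the second derivatives of \<open>G\<close> (\<open>parallel_form_curvature\<close>). Written for the
  candidate at the point \<open>v\<close>, antisymmetry of the curvature is antisymmetry of its conjugate by
  \<open>exp (\<Gamma> v)\<close> with respect to \<open>g\<^sub>0\<close>, the stated condition.

  For the converse the candidate has to be differentiated in directions that are not radial. The
  map \<open>x \<mapsto> exp (\<Gamma> x)\<close> has no simple derivative, as the operators \<open>\<Gamma> x\<close> do not commute. Instead, the
  candidate at \<open>x + w\<close> is compared with its expected first-order expansion at \<open>x\<close> by scaling both
  points by \<open>s\<close> from the origin. Along the ray through \<open>x + w\<close>, the expansion satisfies the same
  differential equation as the candidate, up to a curvature term, which vanishes by the
  antisymmetry condition, and an error quadratic in \<open>w\<close> (\<open>deviation_derivative\<close>). Hence the candidate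
  is differentiable and parallel. It is then smooth as well, since the derivatives of the coefficients
  of a parallel form are sums of coefficients of the same form, which are differentiable again
  (\<open>smooth_parallel_form\<close>).\<close>

section \<open>Product rules, remainders and second derivatives\<close>

text \<open>Differentiability of the family is required pointwise only, so that no norm on the space of
  linear maps is involved; a basis expansion of the argument suffices in finite dimension.\<close>

lemma has_derivative_linear_family:
  fixes M :: "'c::real_normed_vector \<Rightarrow> 'a::euclidean_space \<Rightarrow> 'b::real_normed_vector"
  assumes lin: "\<And>x. linear (M x)"
    and M: "\<And>u. ((\<lambda>x. M x u) has_derivative M' u) (at x0)"
    and Y: "(Y has_derivative Y') (at x0)"
  shows "((\<lambda>x. M x (Y x)) has_derivative (\<lambda>h. M' (Y x0) h + M x0 (Y' h))) (at x0)"
proof -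
  have expand: "M x u = (\<Sum>i\<in>Basis. (u \<bullet> i) *\<^sub>R M x i)" for x u
  proof -
    have "M x u = M x (\<Sum>i\<in>Basis. (u \<bullet> i) *\<^sub>R i)"
      by (simp add: euclidean_representation)
    also have "\<dots> = (\<Sum>i\<in>Basis. (u \<bullet> i) *\<^sub>R M x i)"
      by (simp add: linear_sum[OF lin] linear_cmul[OF lin])
    finally show ?thesis .
  qed
  \<comment> \<open>Splitting off the constant argument \<open>Y x0\<close> makes the coefficients of the sum vanish at \<open>x0\<close>,
    so that the derivatives of \<open>M x i\<close> do not contribute.\<close>
  have eq: "M x (Y x) = M x (Y x0) + (\<Sum>i\<in>Basis. ((Y x - Y x0) \<bullet> i) *\<^sub>R M x i)" for x
    unfolding expand[of x "Y x - Y x0", symmetric] linear_diff[OF lin] by simp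
  have "((\<lambda>x. M x (Y x0) + (\<Sum>i\<in>Basis. ((Y x - Y x0) \<bullet> i) *\<^sub>R M x i)) has_derivative
      (\<lambda>h. M' (Y x0) h + (\<Sum>i\<in>Basis. ((Y x0 - Y x0) \<bullet> i) *\<^sub>R M' i h + (Y' h \<bullet> i) *\<^sub>R M x0 i))) (at x0)"
    by (auto intro!: derivative_eq_intros M Y)
  then show ?thesis
    unfolding eq[abs_def] by (simp add: expand[of x0 "Y' _", symmetric])
qed

lemma has_derivative_bilinear_family:
  fixes G :: "'c::real_normed_vector \<Rightarrow> 'a::euclidean_space \<Rightarrow> 'b::euclidean_space \<Rightarrow> 'd::real_normed_vector"
  assumes bil: "\<And>x. bilinear (G x)"
    and G: "\<And>u v. ((\<lambda>x. G x u v) has_derivative G' u v) (at x0)"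
    and Y: "(Y has_derivative Y') (at x0)" and Z: "(Z has_derivative Z') (at x0)"
  shows "((\<lambda>x. G x (Y x) (Z x)) has_derivative
    (\<lambda>h. G' (Y x0) (Z x0) h + G x0 (Y x0) (Z' h) + G x0 (Y' h) (Z x0))) (at x0)"
proof -
  have lin: "linear (\<lambda>u. G x u v)" "linear (G x u)" for x u v
    using bil by (auto simp: bilinear_def)
  have "((\<lambda>x. G x u (Z x)) has_derivative (\<lambda>h. G' u (Z x0) h + G x0 u (Z' h))) (at x0)" for u
    using has_derivative_linear_family[where M="\<lambda>x. G x u", OF lin(2) G Z] .
  from has_derivative_linear_family[where M="\<lambda>x u. G x u (Z x)", OF lin(1) this Y]
  show ?thesis .
qed

lemma zero_derivative_imp_constant:
  fixes f :: "real \<Rightarrow> 'b::real_normed_vector"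
  assumes "\<And>s. (f has_derivative (\<lambda>h. 0)) (at s)"
  shows "f s = f t"
proof -
  have "\<exists>c. \<forall>s\<in>UNIV. f s = c"
    using assms by (intro has_derivative_zero_constant) auto
  then show ?thesis by auto
qed

lemma has_derivative_quadratic_remainder:
  fixes f :: "'a::euclidean_space \<Rightarrow> 'b::real_normed_vector"
  assumes lin: "linear f'"
    and rem: "\<And>w. norm w \<le> 1 \<Longrightarrow> norm (f (x + w) - f x - f' w) \<le> K * norm w ^ 2"
  shows "(f has_derivative f') (at x)"
  unfolding has_derivative_at_alt
proof (intro conjI allI impI)
  show "bounded_linear f'" using lin by (simp add: linear_conv_bounded_linear)
  fix e :: real assume e: "e > 0"
  define d where "d = min 1 (e / (\<bar>K\<bar> + 1))"
  have d: "d > 0" "d \<le> 1" "d \<le> e / (\<bar>K\<bar> + 1)"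
    using e by (auto simp: d_def)
  have Kd: "(\<bar>K\<bar> + 1) * d \<le> e"
    using d(3) by (simp add: pos_le_divide_eq mult.commute)
  show "\<exists>d>0. \<forall>y. norm (y - x) < d \<longrightarrow> norm (f y - f x - f' (y - x)) \<le> e * norm (y - x)"
  proof (intro exI[of _ d] conjI allI impI)
    fix y assume y: "norm (y - x) < d"
    have "norm (f y - f x - f' (y - x)) \<le> K * norm (y - x) ^ 2"
      using rem[of "y - x"] y d by simp
    also have "\<dots> \<le> ((\<bar>K\<bar> + 1) * norm (y - x)) * norm (y - x)"
      by (simp add: power2_eq_square mult.assoc mult_right_mono)
    also have "\<dots> \<le> ((\<bar>K\<bar> + 1) * d) * norm (y - x)"
      using y by (intro mult_right_mono mult_left_mono) auto
    also have "\<dots> \<le> e * norm (y - x)"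
      using Kd by (intro mult_right_mono) auto
    finally show "norm (f y - f x - f' (y - x)) \<le> e * norm (y - x)" .
  qed (use d in auto)
qed

text \<open>The second difference of \<open>f\<close> over a small parallelogram, divided by \<open>t\<^sup>2\<close>, tends to the second
  derivative. As the second difference is symmetric in \<open>v\<close> and \<open>w\<close>, so are the second derivatives.\<close>

lemma second_difference_approximation:
  fixes f p :: "'a::real_normed_vector \<Rightarrow> real"
  assumes f: "\<And>y. (f has_derivative f' y) (at y)" and p: "\<And>y. f' y w = p y"
    and p': "(p has_derivative p') (at x)" and e: "e > 0"
  shows "\<exists>d>0. \<forall>t. 0 < t \<and> t < d \<longrightarrow>
    \<bar>f (x + t *\<^sub>R v + t *\<^sub>R w) - f (x + t *\<^sub>R v) - f (x + t *\<^sub>R w) + f x - t\<^sup>2 * p' v\<bar>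
      \<le> 2 * e * t\<^sup>2 * (norm v + norm w)"
proof -
  interpret p': bounded_linear p' using p' by (rule has_derivative_bounded_linear)
  obtain d where d: "d > 0"
    "\<And>y. norm (y - x) < d \<Longrightarrow> \<bar>p y - p x - p' (y - x)\<bar> \<le> e * norm (y - x)"
    using p' e unfolding has_derivative_at_alt real_norm_def by blast
  define d' where "d' = d / (norm v + norm w + 1)"
  have pos: "norm v + norm w + 1 > 0" by (simp add: add_nonneg_pos)
  have "d' > 0" using d pos by (simp add: d'_def)
  moreover have "\<bar>f (x + t *\<^sub>R v + t *\<^sub>R w) - f (x + t *\<^sub>R v) - f (x + t *\<^sub>R w) + f x - t\<^sup>2 * p' v\<bar>
      \<le> 2 * e * t\<^sup>2 * (norm v + norm w)" if t: "0 < t" "t < d'" for t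
  proof -
    define h where "h = (\<lambda>s. f (x + t *\<^sub>R v + s *\<^sub>R w) - f (x + s *\<^sub>R w))"
    \<comment> \<open>The mean value theorem for \<open>h\<close> reduces the second difference to a first difference of \<open>p\<close>.\<close>
    have line: "((\<lambda>s. f (y + s *\<^sub>R w)) has_real_derivative p (y + s *\<^sub>R w)) (at s)" for y s
    proof -
      have "((\<lambda>s. f (y + s *\<^sub>R w)) has_derivative (\<lambda>r. f' (y + s *\<^sub>R w) (r *\<^sub>R w))) (at s)"
        by (rule has_derivative_compose[OF _ f]) (auto intro!: derivative_eq_intros)
      moreover have "f' y (r *\<^sub>R w) = p y * r" for y r
        using linear_cmul[OF has_derivative_linear[OF f[of y]], of r w] by (simp add: p)
      ultimately show ?thesis by (simp add: has_field_derivative_def)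
    qed
    have "(h has_real_derivative p (x + t *\<^sub>R v + s *\<^sub>R w) - p (x + s *\<^sub>R w)) (at s)" for s
      unfolding h_def by (intro DERIV_diff line)
    then obtain s where s: "0 < s" "s < t"
      "h t - h 0 = (t - 0) * (p (x + t *\<^sub>R v + s *\<^sub>R w) - p (x + s *\<^sub>R w))"
      using MVT2[OF t(1), of h "\<lambda>s. p (x + t *\<^sub>R v + s *\<^sub>R w) - p (x + s *\<^sub>R w)"] by blast
    have small: "t * (norm v + norm w) < d"
    proof -
      have "t * (norm v + norm w) \<le> t * (norm v + norm w + 1)" using t by simp
      also have "\<dots> < d" using t pos by (simp add: d'_def field_simps)
      finally show ?thesis .
    qed
    have sw: "norm (s *\<^sub>R w) \<le> t * (norm v + norm w)"
      using s t by (simp add: mult_mono)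
    have tvsw: "norm (t *\<^sub>R v + s *\<^sub>R w) \<le> t * (norm v + norm w)"
    proof -
      have "norm (t *\<^sub>R v + s *\<^sub>R w) \<le> t * norm v + s * norm w"
        using norm_triangle_ineq[of "t *\<^sub>R v" "s *\<^sub>R w"] s t by simp
      also have "\<dots> \<le> t * norm v + t * norm w" using s by (simp add: mult_right_mono)
      finally show ?thesis by (simp add: distrib_left)
    qed
    have near: "\<bar>p (x + z) - p x - p' z\<bar> \<le> e * (t * (norm v + norm w))"
      if z: "norm z \<le> t * (norm v + norm w)" for z
    proof -
      have "\<bar>p (x + z) - p x - p' z\<bar> \<le> e * norm z"
        using d(2)[of "x + z"] z small by simp
      also have "\<dots> \<le> e * (t * (norm v + norm w))"
        using z e by (intro mult_left_mono) auto
      finally show ?thesis .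
    qed
    have "\<bar>p (x + t *\<^sub>R v + s *\<^sub>R w) - p (x + s *\<^sub>R w) - t * p' v\<bar> \<le> 2 * (e * (t * (norm v + norm w)))"
      using near[OF tvsw] near[OF sw] by (simp add: p'.add p'.scaleR add.assoc)
    then have "t * \<bar>p (x + t *\<^sub>R v + s *\<^sub>R w) - p (x + s *\<^sub>R w) - t * p' v\<bar>
        \<le> t * (2 * (e * (t * (norm v + norm w))))"
      using t by (intro mult_left_mono) auto
    moreover have "t * \<bar>p (x + t *\<^sub>R v + s *\<^sub>R w) - p (x + s *\<^sub>R w) - t * p' v\<bar> = \<bar>h t - h 0 - t\<^sup>2 * p' v\<bar>"
    proof -
      have "h t - h 0 - t\<^sup>2 * p' v = t * (p (x + t *\<^sub>R v + s *\<^sub>R w) - p (x + s *\<^sub>R w) - t * p' v)"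
        by (simp add: s(3) power2_eq_square algebra_simps)
      then show ?thesis using t by (simp add: abs_mult)
    qed
    ultimately show ?thesis by (simp add: h_def power2_eq_square algebra_simps)
  qed
  ultimately show ?thesis by blast
qed

lemma symmetric_second_derivatives:
  fixes f p q :: "'a::real_normed_vector \<Rightarrow> real"
  assumes f: "\<And>y. (f has_derivative f' y) (at y)"
    and p: "\<And>y. f' y w = p y" and q: "\<And>y. f' y v = q y"
    and p': "(p has_derivative p') (at x)" and q': "(q has_derivative q') (at x)"
  shows "p' v = q' w"
proof -
  define N where "N = norm v + norm w"
  have le: "\<bar>p' v - q' w\<bar> \<le> 4 * e * N" if e: "e > 0" for e
  proof -
    obtain d1 d2 where d: "d1 > 0" "d2 > 0"
      and 1: "\<And>t. 0 < t \<and> t < d1 \<Longrightarrow>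
        \<bar>f (x + t *\<^sub>R v + t *\<^sub>R w) - f (x + t *\<^sub>R v) - f (x + t *\<^sub>R w) + f x - t\<^sup>2 * p' v\<bar> \<le> 2 * e * t\<^sup>2 * N"
      and 2: "\<And>t. 0 < t \<and> t < d2 \<Longrightarrow>
        \<bar>f (x + t *\<^sub>R w + t *\<^sub>R v) - f (x + t *\<^sub>R w) - f (x + t *\<^sub>R v) + f x - t\<^sup>2 * q' w\<bar> \<le> 2 * e * t\<^sup>2 * N"
      using second_difference_approximation[OF f p p' e, of v]
        second_difference_approximation[OF f q q' e, of w]
      unfolding N_def add.commute[of "norm w" "norm v"] by blast
    define t where "t = min d1 d2 / 2"
    have t: "0 < t" "t < d1" "t < d2" using d by (auto simp: t_def)
    have "\<bar>t\<^sup>2 * p' v - t\<^sup>2 * q' w\<bar> \<le> 4 * e * t\<^sup>2 * N"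
      using 1[of t] 2[of t] t by (simp add: add.assoc add.commute[of "t *\<^sub>R w"])
    moreover have "\<bar>t\<^sup>2 * p' v - t\<^sup>2 * q' w\<bar> = t\<^sup>2 * \<bar>p' v - q' w\<bar>"
      by (simp add: abs_mult flip: right_diff_distrib)
    ultimately have "t\<^sup>2 * \<bar>p' v - q' w\<bar> \<le> t\<^sup>2 * (4 * e * N)" by (simp add: mult_ac)
    then show ?thesis using t by simp
  qed
  have "N \<ge> 0" by (simp add: N_def)
  have "\<bar>p' v - q' w\<bar> \<le> e" if "e > 0" for e
  proof -
    have "\<bar>p' v - q' w\<bar> \<le> 4 * (e / (4 * (N + 1))) * N"
      using le[of "e / (4 * (N + 1))"] that \<open>N \<ge> 0\<close> by simp
    also have "\<dots> = e * (N / (N + 1))" using \<open>N \<ge> 0\<close> by (simp add: divide_simps)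
    also have "\<dots> \<le> e * 1" using that \<open>N \<ge> 0\<close> by (intro mult_left_mono) auto
    also have "\<dots> = e" by simp
    finally show ?thesis .
  qed
  then show ?thesis using field_le_epsilon[of "\<bar>p' v - q' w\<bar>" 0] by simp
qed

section \<open>The exponential of a linear operator\<close>

lemma linear_funpow:
  fixes A :: "'a::real_vector \<Rightarrow> 'a"
  assumes "linear A"
  shows "linear (A ^^ k)"
proof (induction k)
  case 0
  show ?case using linear_id by (simp add: id_def)
next
  case (Suc k)
  from linear_compose[OF this assms] show ?case by (simp add: o_def)
qed

context
  fixes A :: "'a::euclidean_space \<Rightarrow> 'a"
  assumes A: "linear A"
begin

lemma operator_exp_sums: "(\<lambda>k. (1 / fact k) *\<^sub>R (A ^^ k) x) sums operator_exp A x"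
  unfolding operator_exp_def
  by (rule summable_sums[OF summable_norm_cancel[OF summable_operator_exp[OF A]]])

lemma linear_operator_exp: "linear (operator_exp A)"
proof (rule linearI)
  note lin = linear_add[OF linear_funpow[OF A]] linear_cmul[OF linear_funpow[OF A]]
  show "operator_exp A (x + y) = operator_exp A x + operator_exp A y" for x y
  proof -
    have "(\<lambda>k. (1 / fact k) *\<^sub>R (A ^^ k) (x + y)) sums (operator_exp A x + operator_exp A y)"
      using sums_add[OF operator_exp_sums[of x] operator_exp_sums[of y]]
      by (simp add: lin scaleR_add_right)
    then show ?thesis by (rule sums_unique2[OF operator_exp_sums])
  qed
  show "operator_exp A (r *\<^sub>R x) = r *\<^sub>R operator_exp A x" for r x
  proof -
    have "(\<lambda>k. (1 / fact k) *\<^sub>R (A ^^ k) (r *\<^sub>R x)) sums (r *\<^sub>R operator_exp A x)"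
      using sums_scaleR_right[OF operator_exp_sums[of x], of r] by (simp add: lin)
    then show ?thesis by (rule sums_unique2[OF operator_exp_sums])
  qed
qed

lemma operator_exp_commute:
  assumes B: "linear B" and comm: "\<And>x. B (A x) = A (B x)"
  shows "B (operator_exp A x) = operator_exp A (B x)"
proof -
  have pow: "B ((A ^^ k) x) = (A ^^ k) (B x)" for k
    by (induction k) (simp_all add: comm)
  have "(\<lambda>k. B ((1 / fact k) *\<^sub>R (A ^^ k) x)) sums B (operator_exp A x)"
    using B by (intro bounded_linear.sums[of B] operator_exp_sums) (simp add: linear_conv_bounded_linear)
  then have "(\<lambda>k. (1 / fact k) *\<^sub>R (A ^^ k) (B x)) sums B (operator_exp A x)"
    by (simp add: linear_cmul[OF B] pow)
  then show ?thesis by (rule sums_unique2[OF _ operator_exp_sums])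
qed

lemma norm_operator_exp_le:
  assumes K: "\<And>x. norm (A x) \<le> K * norm x" and "K \<ge> 0"
  shows "norm (operator_exp A x) \<le> exp K * norm x"
proof -
  have le: "norm ((A ^^ k) x) \<le> K ^ k * norm x" for k
  proof (induction k)
    case (Suc k)
    have "norm ((A ^^ Suc k) x) \<le> K * norm ((A ^^ k) x)" using K by simp
    also have "\<dots> \<le> K * (K ^ k * norm x)" using Suc \<open>K \<ge> 0\<close> by (intro mult_left_mono) auto
    finally show ?case by (simp add: mult.assoc)
  qed simp
  have sums: "(\<lambda>k. (K ^ k /\<^sub>R fact k) * norm x) sums (exp K * norm x)"
    by (intro sums_mult2 exp_converges)
  have "norm ((1 / fact k) *\<^sub>R (A ^^ k) x) \<le> (K ^ k /\<^sub>R fact k) * norm x" for k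
    using mult_left_mono[OF le[of k], of "inverse (fact k)"] by (simp add: divide_inverse mult.assoc)
  then have "norm (\<Sum>k. (1 / fact k) *\<^sub>R (A ^^ k) x) \<le> (\<Sum>k. (K ^ k /\<^sub>R fact k) * norm x)"
    by (rule norm_suminf_le[OF _ sums_summable[OF sums]])
  then show ?thesis using sums_unique[OF sums] by (simp add: operator_exp_def)
qed

end

lemma operator_exp_zero: "operator_exp (\<lambda>x. 0) v = (v :: 'a::euclidean_space)"
proof -
  have "((\<lambda>x. 0) ^^ k) v = (0 :: 'a)" if "k \<noteq> 0" for k
    using that by (cases k) auto
  then show ?thesis
    unfolding operator_exp_def by (subst suminf_finite[of "{0}"]) auto
qed

text \<open>Each coordinate of the orbit of \<open>v\<close> is an everywhere convergent power series in \<open>s\<close>, which may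
  be differentiated termwise.\<close>

lemma has_vector_derivative_operator_exp:
  assumes A: "linear (A :: 'a::euclidean_space \<Rightarrow> 'a)"
  shows "((\<lambda>s. operator_exp (\<lambda>x. s *\<^sub>R A x) v) has_vector_derivative
    operator_exp (\<lambda>x. s *\<^sub>R A x) (A v)) (at s)"
proof -
  let ?E = "\<lambda>s v. operator_exp (\<lambda>x. s *\<^sub>R A x) v"
  define c where "c = (\<lambda>v i k. (1 / fact k) * ((A ^^ k) v \<bullet> i))"
  have sums: "(\<lambda>k. c v i k * s ^ k) sums (?E s v \<bullet> i)" for s v i
  proof -
    have "((\<lambda>x. s *\<^sub>R A x) ^^ k) v = s ^ k *\<^sub>R (A ^^ k) v" for k
      by (induction k) (simp_all add: linear_cmul[OF A])
    then show ?thesis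
      using bounded_linear.sums[OF bounded_linear_inner_left operator_exp_sums[OF linear_compose_scale_right[OF A]], of s v i]
      by (simp add: c_def mult_ac)
  qed
  have "((\<lambda>s. ?E s v \<bullet> i) has_real_derivative ?E s (A v) \<bullet> i) (at s)" for i
  proof -
    have diffs: "diffs (c v i) = c (A v) i"
      by (auto simp: diffs_def c_def funpow_swap1 fun_eq_iff field_simps simp del: of_nat_Suc)
    have "((\<lambda>s. \<Sum>k. c v i k * s ^ k) has_real_derivative (\<Sum>k. diffs (c v i) k * s ^ k)) (at s)"
      by (intro termdiffs_strong_converges_everywhere sums_summable[OF sums])
    then show ?thesis unfolding diffs by (simp add: sums_unique[OF sums, symmetric])
  qed
  then show ?thesis
    unfolding has_vector_derivative_def has_field_derivative_def
    by (subst has_derivative_componentwise_within) (simp add: mult_commute_abs)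
qed

lemma has_vector_derivative_operator_exp_apply:
  assumes A: "linear (A :: 'a::euclidean_space \<Rightarrow> 'a)"
    and y: "(y has_vector_derivative y') (at s)"
  shows "((\<lambda>s. operator_exp (\<lambda>x. s *\<^sub>R A x) (y s)) has_vector_derivative
    operator_exp (\<lambda>x. s *\<^sub>R A x) (A (y s) + y')) (at s)"
proof -
  let ?E = "\<lambda>s. operator_exp (\<lambda>x. s *\<^sub>R A x)"
  have lin: "linear (?E s)" for s
    by (intro linear_operator_exp linear_compose_scale_right A)
  have "((\<lambda>s. ?E s (y s)) has_derivative (\<lambda>h. h *\<^sub>R ?E s (A (y s)) + ?E s (h *\<^sub>R y'))) (at s)"
    by (rule has_derivative_linear_family[where M="?E", OF lin])
      (use has_vector_derivative_operator_exp[OF A] y in \<open>auto simp: has_vector_derivative_def\<close>)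
  then show ?thesis
    by (simp add: has_vector_derivative_def linear_add[OF lin] linear_cmul[OF lin] scaleR_add_right)
qed

text \<open>The product of the two one-parameter families \<open>exp (s A)\<close> and \<open>exp (- s A)\<close> has derivative zero
  in \<open>s\<close>; this replaces the Cauchy product of the two series.\<close>

lemma operator_exp_minus_cancel:
  assumes A: "linear (A :: 'a::euclidean_space \<Rightarrow> 'a)"
  shows "operator_exp A (operator_exp (\<lambda>x. - A x) v) = v"
proof -
  let ?y = "\<lambda>s. operator_exp (\<lambda>x. s *\<^sub>R - A x) v"
  let ?f = "\<lambda>s. operator_exp (\<lambda>x. s *\<^sub>R A x) (?y s)"
  note A' = linear_compose_neg[OF A]
  have "(?f has_vector_derivative 0) (at s)" for s
  proof -
    have "(?y has_vector_derivative operator_exp (\<lambda>x. s *\<^sub>R - A x) (- A v)) (at s)"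
      by (rule has_vector_derivative_operator_exp[OF A'])
    moreover have "- A (?y s) = operator_exp (\<lambda>x. s *\<^sub>R - A x) (- A v)"
      by (rule operator_exp_commute[OF linear_compose_scale_right[OF A'] A'])
        (simp add: linear_neg[OF A] linear_cmul[OF A])
    ultimately have "(?y has_vector_derivative - A (?y s)) (at s)" by simp
    from has_vector_derivative_operator_exp_apply[OF A this]
    show ?thesis
      using linear_0[OF linear_operator_exp[OF linear_compose_scale_right[OF A]]] by simp
  qed
  then have "?f 1 = ?f 0"
    by (intro zero_derivative_imp_constant[of ?f]) (simp add: has_vector_derivative_def)
  also have "?f 0 = v" by (simp add: operator_exp_zero)
  finally show ?thesis by simp
qed

lemma operator_exp_minus_cancel':
  assumes A: "linear (A :: 'a::euclidean_space \<Rightarrow> 'a)"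
  shows "operator_exp (\<lambda>x. - A x) (operator_exp A v) = v"
  using operator_exp_minus_cancel[OF linear_compose_neg[OF A]] by simp


section \<open>The metric obtained by parallel transport along rays\<close>

text \<open>The pullback of \<open>g\<close> under parallel transport from \<open>x\<close> to the origin along the ray: a parallel
  field \<open>Y\<close> along \<open>s \<mapsto> s *\<^sub>R x\<close> solves \<open>Y' = - \<Gamma> x Y\<close>, so \<open>Y 0 = operator_exp (\<Gamma> x) (Y 1)\<close>.\<close>

definition transported_form ::
    "('a::euclidean_space \<Rightarrow> 'a \<Rightarrow> 'a) \<Rightarrow> ('a \<Rightarrow> 'a \<Rightarrow> real) \<Rightarrow> 'a \<Rightarrow> 'a \<Rightarrow> 'a \<Rightarrow> real" where
  "transported_form \<Gamma> g x a b = g (operator_exp (\<Gamma> x) a) (operator_exp (\<Gamma> x) b)"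

text \<open>The equation \<open>\<nabla>G = 0\<close>, evaluated on constant vector fields.\<close>

definition parallel_form ::
    "('a::euclidean_space \<Rightarrow> 'a \<Rightarrow> 'a) \<Rightarrow> ('a \<Rightarrow> 'a \<Rightarrow> 'a \<Rightarrow> real) \<Rightarrow> bool" where
  "parallel_form \<Gamma> G \<longleftrightarrow>
    (\<forall>x a b. ((\<lambda>x. G x a b) has_derivative (\<lambda>w. G x (\<Gamma> w a) b + G x a (\<Gamma> w b))) (at x))"

text \<open>With \<open>A = \<Gamma> x\<close> and \<open>B = \<Gamma> w\<close>, apply the first-order candidate at \<open>s *\<^sub>R (x + w)\<close>, built from the
  transported form at \<open>s *\<^sub>R x\<close>, to two fields that are parallel along the ray through \<open>x + w\<close>. If the
  candidate were exact, the result would not depend on \<open>s\<close>. In its derivative the terms of order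
  zero in \<open>B\<close> cancel because \<open>operator_exp (s *\<^sub>R A)\<close> and the parallel fields are transported by
  opposite generators, and the terms of order one because the derivative of the explicit factor \<open>s\<close>
  compensates them, up to a multiple of \<open>s\<close> that involves \<open>commutator A B\<close>; this last one is removed
  by antisymmetry. Only terms of order two remain.\<close>

lemma deviation_derivative:
  fixes A B :: "'a::euclidean_space \<Rightarrow> 'a" and g :: "'a \<Rightarrow> 'a \<Rightarrow> real"
  assumes A: "linear A" and B: "linear B" and g: "bilinear g"
    and anti: "antisymmetric_wrt g
      (operator_exp (\<lambda>x. s *\<^sub>R A x) \<circ> commutator A B \<circ> operator_exp (\<lambda>x. - (s *\<^sub>R A x)))"
  defines "E \<equiv> \<lambda>s. operator_exp (\<lambda>x. s *\<^sub>R A x)"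
    and "y \<equiv> \<lambda>s a. operator_exp (\<lambda>x. s *\<^sub>R - (A x + B x)) a"
  shows "((\<lambda>s. g (E s (y s a)) (E s (y s b)) +
      s * (g (E s (B (y s a))) (E s (y s b)) + g (E s (y s a)) (E s (B (y s b)))))
    has_real_derivative
      - s * (g (E s (B (B (y s a)))) (E s (y s b)) + 2 * g (E s (B (y s a))) (E s (B (y s b)))
        + g (E s (y s a)) (E s (B (B (y s b)))))) (at s)"
proof -
  define C where "C = (\<lambda>x. - (A x + B x))"
  have C: "linear C"
    unfolding C_def by (intro linear_compose_neg linear_compose_add A B)
  have linE: "linear (E s)" for s
    unfolding E_def by (intro linear_operator_exp linear_compose_scale_right A)
  have y: "((\<lambda>s. y s a) has_vector_derivative C (y s a)) (at s)" for a
  proof -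
    have y_eq: "y = (\<lambda>s a. operator_exp (\<lambda>x. s *\<^sub>R C x) a)"
      unfolding y_def C_def by (rule refl)
    have "C (y s a) = operator_exp (\<lambda>x. s *\<^sub>R C x) (C a)"
      unfolding y_eq
      by (rule operator_exp_commute[OF linear_compose_scale_right[OF C] C]) (rule linear_cmul[OF C])
    then show ?thesis
      using has_vector_derivative_operator_exp[OF C, of a s] unfolding y_eq by simp
  qed
  have By: "((\<lambda>s. B (y s a)) has_vector_derivative B (C (y s a))) (at s)" for a
    using B by (intro bounded_linear.has_vector_derivative[where f=B] y)
      (simp add: linear_conv_bounded_linear)
  have E_apply: "((\<lambda>s. E s (z s)) has_vector_derivative E s (A (z s) + z')) (at s)"
    if "(z has_vector_derivative z') (at s)" for z z'
    unfolding E_def by (rule has_vector_derivative_operator_exp_apply[OF A that])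
  have p: "((\<lambda>s. E s (y s a)) has_vector_derivative - E s (B (y s a))) (at s)" for a
    using E_apply[OF y, of a] by (simp add: C_def linear_neg[OF linE])
  have q: "((\<lambda>s. E s (B (y s a))) has_vector_derivative
      E s (commutator A B (y s a)) - E s (B (B (y s a)))) (at s)" for a
  proof -
    have "A (B (y s a)) + B (C (y s a)) = commutator A B (y s a) - B (B (y s a))"
      by (simp add: C_def commutator_def linear_neg[OF B] linear_diff[OF B] linear_add[OF B])
    then show ?thesis using E_apply[OF By, of a] by (simp add: linear_diff[OF linE])
  qed
  have cancel: "operator_exp (\<lambda>x. - (s *\<^sub>R A x)) (E s u) = u" for u
    unfolding E_def by (rule operator_exp_minus_cancel'[OF linear_compose_scale_right[OF A]])
  have "antisymmetric_wrt g (E s \<circ> commutator A B \<circ> operator_exp (\<lambda>x. - (s *\<^sub>R A x)))"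
    using anti unfolding E_def .
  then have flat: "g (E s (commutator A B u)) (E s v) + g (E s u) (E s (commutator A B v)) = 0" for u v
    unfolding antisymmetric_wrt_def by (metis cancel comp_apply)
  interpret g: bounded_bilinear g
    using g by (simp add: bilinear_conv_bounded_bilinear)
  note g_deriv = g.has_vector_derivative[folded has_real_derivative_iff_has_vector_derivative]
  have "((\<lambda>s. g (E s (y s a)) (E s (y s b)) +
      s * (g (E s (B (y s a))) (E s (y s b)) + g (E s (y s a)) (E s (B (y s b)))))
    has_real_derivative
      (g (E s (y s a)) (- E s (B (y s b))) + g (- E s (B (y s a))) (E s (y s b))) +
      (1 * (g (E s (B (y s a))) (E s (y s b)) + g (E s (y s a)) (E s (B (y s b)))) +
       ((g (E s (B (y s a))) (- E s (B (y s b))) +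
         g (E s (commutator A B (y s a)) - E s (B (B (y s a)))) (E s (y s b))) +
        (g (E s (y s a)) (E s (commutator A B (y s b)) - E s (B (B (y s b)))) +
         g (- E s (B (y s a))) (E s (B (y s b))))) * s)) (at s)"
    by (intro DERIV_add DERIV_mult DERIV_ident g_deriv p q)
  then show ?thesis
  proof (rule DERIV_cong)
    have "g (E s (commutator A B (y s a))) (E s (y s b)) * s +
        g (E s (y s a)) (E s (commutator A B (y s b))) * s = 0"
      using flat[of "y s a" "y s b"] by (simp flip: distrib_right)
    then show "(g (E s (y s a)) (- E s (B (y s b))) + g (- E s (B (y s a))) (E s (y s b))) +
      (1 * (g (E s (B (y s a))) (E s (y s b)) + g (E s (y s a)) (E s (B (y s b)))) +
       ((g (E s (B (y s a))) (- E s (B (y s b))) +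
         g (E s (commutator A B (y s a)) - E s (B (B (y s a)))) (E s (y s b))) +
        (g (E s (y s a)) (E s (commutator A B (y s b)) - E s (B (B (y s b)))) +
         g (- E s (B (y s a))) (E s (B (y s b))))) * s) =
      - s * (g (E s (B (B (y s a)))) (E s (y s b)) + 2 * g (E s (B (y s a))) (E s (B (y s b)))
        + g (E s (y s a)) (E s (B (B (y s b)))))"
      by (simp add: g.minus_left g.minus_right g.diff_left g.diff_right algebra_simps)
  qed
qed

lemma linear_bilinear_right: "bilinear \<Gamma> \<Longrightarrow> linear (\<Gamma> x)"
  by (simp add: bilinear_def)

lemma bilinear_transported_form:
  assumes "bilinear \<Gamma>" and g: "bilinear g"
  shows "bilinear (transported_form \<Gamma> g x)"
proof -
  have lin: "linear (operator_exp (\<Gamma> x))"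
    by (intro linear_operator_exp linear_bilinear_right assms)
  show ?thesis
    unfolding bilinear_def transported_form_def
    by (auto intro!: linearI
        simp: linear_add[OF lin] linear_cmul[OF lin] bilinear_ladd[OF g] bilinear_radd[OF g]
          bilinear_lmul[OF g] bilinear_rmul[OF g])
qed

text \<open>The derivative computed in \<open>deviation_derivative\<close> is bounded by a multiple of the square of the
  norm of \<open>w\<close>, uniformly for \<open>s\<close> between 0 and 1, because all exponentials that occur belong to points
  of norm at most \<open>norm x + 1\<close>. The parallel fields are chosen to take the values \<open>a\<close> and \<open>b\<close> at
  \<open>s = 1\<close>; the deviation then runs from the transported form at \<open>x + w\<close> to its expansion at \<open>x\<close>.\<close>

lemma transported_form_remainder:
  fixes \<Gamma> :: "'a::euclidean_space \<Rightarrow> 'a \<Rightarrow> 'a" and g :: "'a \<Rightarrow> 'a \<Rightarrow> real"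
  assumes \<Gamma>: "bilinear \<Gamma>" and g: "bilinear g"
    and flat: "\<And>v w\<^sub>1 w\<^sub>2. antisymmetric_wrt g
      (operator_exp (\<Gamma> v) \<circ> commutator (\<Gamma> w\<^sub>1) (\<Gamma> w\<^sub>2) \<circ> operator_exp (\<lambda>x. - \<Gamma> v x))"
  shows "\<exists>K. \<forall>w. norm w \<le> 1 \<longrightarrow>
    \<bar>transported_form \<Gamma> g (x + w) a b - transported_form \<Gamma> g x a b
      - (transported_form \<Gamma> g x (\<Gamma> w a) b + transported_form \<Gamma> g x a (\<Gamma> w b))\<bar> \<le> K * norm w ^ 2"
proof -
  obtain c where c: "c > 0" "\<And>u v. norm (\<Gamma> u v) \<le> c * norm u * norm v"
    using bilinear_bounded_pos[OF \<Gamma>] by blast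
  obtain D where D: "D > 0" "\<And>u v. \<bar>g u v\<bar> \<le> D * norm u * norm v"
    using bilinear_bounded_pos[OF g] by auto
  define m where "m = exp (c * (norm x + 1))"
  have m: "m > 0" by (simp add: m_def)
  \<comment> \<open>The factor 4 counts the terms quadratic in \<open>w\<close>, the middle one having coefficient 2; each vector
    passes through three exponentials, each of norm at most \<open>m\<close>.\<close>
  define K where "K = 4 * D * m\<^sup>2 * c\<^sup>2 * (m * (m * norm a)) * (m * (m * norm b))"
  note lin = linear_bilinear_right[OF \<Gamma>]
  have exp_bound: "norm (operator_exp (\<Gamma> z) u) \<le> m * norm u" if z: "norm z \<le> norm x + 1" for z u
  proof -
    have "c * norm z * norm v \<le> c * (norm x + 1) * norm v" for v
      using c z by (intro mult_right_mono mult_left_mono) auto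
    then have "norm (\<Gamma> z v) \<le> c * (norm x + 1) * norm v" for v
      using c(2)[of z v] order_trans by blast
    then show ?thesis
      unfolding m_def using c(1) by (intro norm_operator_exp_le lin) auto
  qed
  have "\<bar>transported_form \<Gamma> g (x + w) a b - transported_form \<Gamma> g x a b
      - (transported_form \<Gamma> g x (\<Gamma> w a) b + transported_form \<Gamma> g x a (\<Gamma> w b))\<bar> \<le> K * norm w ^ 2"
    if w: "norm w \<le> 1" for w
  proof -
    define E where "E = (\<lambda>s. operator_exp (\<lambda>z. s *\<^sub>R \<Gamma> x z))"
    define y where "y = (\<lambda>s u. operator_exp (\<lambda>z. s *\<^sub>R - (\<Gamma> x z + \<Gamma> w z)) u)"
    define a' where "a' = operator_exp (\<Gamma> (x + w)) a"
    define b' where "b' = operator_exp (\<Gamma> (x + w)) b"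
    define \<phi> where "\<phi> = (\<lambda>s. g (E s (y s a')) (E s (y s b')) +
      s * (g (E s (\<Gamma> w (y s a'))) (E s (y s b')) + g (E s (y s a')) (E s (\<Gamma> w (y s b')))))"
    define \<phi>' where "\<phi>' = (\<lambda>s. - s * (g (E s (\<Gamma> w (\<Gamma> w (y s a')))) (E s (y s b'))
      + 2 * g (E s (\<Gamma> w (y s a'))) (E s (\<Gamma> w (y s b')))
      + g (E s (y s a')) (E s (\<Gamma> w (\<Gamma> w (y s b'))))))"
    have scale: "\<Gamma> (s *\<^sub>R x) = (\<lambda>z. s *\<^sub>R \<Gamma> x z)" for s
      by (rule ext) (rule bilinear_lmul[OF \<Gamma>])
    have E_eq: "E s = operator_exp (\<Gamma> (s *\<^sub>R x))" for s
      by (simp only: E_def scale)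
    have y_eq: "y s = operator_exp (\<Gamma> ((- s) *\<^sub>R (x + w)))" for s
    proof -
      have "\<Gamma> ((- s) *\<^sub>R (x + w)) = (\<lambda>z. s *\<^sub>R - (\<Gamma> x z + \<Gamma> w z))"
        by (rule ext) (simp only: scaleR_minus_left scaleR_minus_right bilinear_lneg[OF \<Gamma>]
            bilinear_lmul[OF \<Gamma>] bilinear_ladd[OF \<Gamma>])
      then show ?thesis by (simp only: y_def)
    qed
    have deriv: "(\<phi> has_real_derivative \<phi>' s) (at s)" for s
      unfolding \<phi>_def \<phi>'_def E_def y_def
    proof (rule deviation_derivative[OF lin lin g])
      show "antisymmetric_wrt g (operator_exp (\<lambda>z. s *\<^sub>R \<Gamma> x z) \<circ> commutator (\<Gamma> x) (\<Gamma> w) \<circ>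
          operator_exp (\<lambda>z. - (s *\<^sub>R \<Gamma> x z)))"
        using flat[of "s *\<^sub>R x" x w] by (simp only: scale)
    qed
    obtain s where s: "0 < s" "s < 1" "\<phi> 1 - \<phi> 0 = (1 - 0) * \<phi>' s"
      using MVT2[of 0 1 \<phi> \<phi>'] deriv by (metis zero_less_one)
    have end0: "\<phi> 0 = transported_form \<Gamma> g (x + w) a b"
      by (simp add: \<phi>_def E_def y_def operator_exp_zero transported_form_def a'_def b'_def)
    have cancel: "y 1 (operator_exp (\<Gamma> (x + w)) u) = u" for u
      using operator_exp_minus_cancel'[OF lin, of "x + w" u]
      by (simp add: y_def bilinear_ladd[OF \<Gamma>])
    have end1: "\<phi> 1 = transported_form \<Gamma> g x a b +
        (transported_form \<Gamma> g x (\<Gamma> w a) b + transported_form \<Gamma> g x a (\<Gamma> w b))"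
      by (simp add: \<phi>_def a'_def b'_def cancel E_eq transported_form_def)
    have nE: "norm (E s u) \<le> m * norm u" for u
      unfolding E_eq using s by (intro exp_bound) (simp add: mult_left_le_one_le add_increasing2)
    have xw: "norm (x + w) \<le> norm x + 1"
      using w norm_triangle_ineq[of x w] by linarith
    have ny: "norm (y s (operator_exp (\<Gamma> (x + w)) u)) \<le> m * (m * norm u)" for u
    proof -
      have "norm ((- s) *\<^sub>R (x + w)) \<le> norm (x + w)"
        using s by (simp add: mult_left_le_one_le)
      then have "norm (y s (operator_exp (\<Gamma> (x + w)) u)) \<le> m * norm (operator_exp (\<Gamma> (x + w)) u)"
        unfolding y_eq using xw by (intro exp_bound) linarith
      also have "\<dots> \<le> m * (m * norm u)"
        using m xw by (intro mult_left_mono exp_bound) auto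
      finally show ?thesis .
    qed
    define \<alpha> where "\<alpha> = m * (m * norm a)"
    define \<beta> where "\<beta> = m * (m * norm b)"
    have \<alpha>\<beta>: "\<alpha> \<ge> 0" "\<beta> \<ge> 0" using m by (auto simp: \<alpha>_def \<beta>_def)
    define r where "r = c * norm w"
    have r: "r \<ge> 0" using c by (simp add: r_def)
    have step: "norm (\<Gamma> w u) \<le> r * t" if "norm u \<le> t" for u t
      using c(2)[of w u] mult_left_mono[OF that r] unfolding r_def by linarith
    have Estep: "norm (E s u) \<le> m * t" if "norm u \<le> t" for u t
      using nE[of u] mult_left_mono[OF that, of m] m by linarith
    have ya: "norm (y s a') \<le> \<alpha>" and yb: "norm (y s b') \<le> \<beta>"
      using ny unfolding a'_def b'_def \<alpha>_def \<beta>_def by auto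
    have gb: "\<bar>g u v\<bar> \<le> D * (t * t')" if "norm u \<le> t" "norm v \<le> t'" for u v t t'
    proof -
      have "norm u * norm v \<le> t * t'"
        using that norm_ge_zero[of u] by (intro mult_mono) (auto intro: order_trans[OF norm_ge_zero])
      then have "D * (norm u * norm v) \<le> D * (t * t')"
        using D(1) by (intro mult_left_mono) auto
      with D(2)[of u v] show ?thesis by (simp add: mult.assoc)
    qed
    have g1: "\<bar>g (E s (\<Gamma> w (\<Gamma> w (y s a')))) (E s (y s b'))\<bar> \<le> D * (m * (r * (r * \<alpha>)) * (m * \<beta>))"
      by (intro gb Estep step ya yb)
    have g2: "\<bar>g (E s (\<Gamma> w (y s a'))) (E s (\<Gamma> w (y s b')))\<bar> \<le> D * (m * (r * \<alpha>) * (m * (r * \<beta>)))"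
      by (intro gb Estep step ya yb)
    have g3: "\<bar>g (E s (y s a')) (E s (\<Gamma> w (\<Gamma> w (y s b'))))\<bar> \<le> D * (m * \<alpha> * (m * (r * (r * \<beta>))))"
      by (intro gb Estep step ya yb)
    define Q where "Q = g (E s (\<Gamma> w (\<Gamma> w (y s a')))) (E s (y s b'))
      + 2 * g (E s (\<Gamma> w (y s a'))) (E s (\<Gamma> w (y s b')))
      + g (E s (y s a')) (E s (\<Gamma> w (\<Gamma> w (y s b'))))"
    have "\<bar>Q\<bar> \<le> D * (m * (r * (r * \<alpha>)) * (m * \<beta>)) + 2 * (D * (m * (r * \<alpha>) * (m * (r * \<beta>))))
        + D * (m * \<alpha> * (m * (r * (r * \<beta>))))"
      unfolding Q_def using g1 g2 g3 by linarith
    also have "\<dots> = K * norm w ^ 2"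
      by (simp add: K_def r_def \<alpha>_def[symmetric] \<beta>_def[symmetric] power2_eq_square)
    finally have Q: "\<bar>Q\<bar> \<le> K * norm w ^ 2" .
    have "\<bar>\<phi>' s\<bar> = s * \<bar>Q\<bar>" unfolding \<phi>'_def Q_def[symmetric] using s by (simp add: abs_mult)
    also have "\<dots> \<le> \<bar>Q\<bar>" using s by (simp add: mult_left_le_one_le)
    finally have "\<bar>\<phi> 1 - \<phi> 0\<bar> \<le> K * norm w ^ 2" using Q s(3) by simp
    then show ?thesis unfolding end0 end1 by linarith
  qed
  then show ?thesis by blast
qed

lemma parallel_transported_form:
  assumes \<Gamma>: "bilinear \<Gamma>" and g: "bilinear g"
    and flat: "\<And>v w\<^sub>1 w\<^sub>2. antisymmetric_wrt g
      (operator_exp (\<Gamma> v) \<circ> commutator (\<Gamma> w\<^sub>1) (\<Gamma> w\<^sub>2) \<circ> operator_exp (\<lambda>x. - \<Gamma> v x))"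
  shows "parallel_form \<Gamma> (transported_form \<Gamma> g)"
  unfolding parallel_form_def
proof (intro allI)
  fix x a b
  obtain K where K: "\<And>w. norm w \<le> 1 \<Longrightarrow>
    \<bar>transported_form \<Gamma> g (x + w) a b - transported_form \<Gamma> g x a b
      - (transported_form \<Gamma> g x (\<Gamma> w a) b + transported_form \<Gamma> g x a (\<Gamma> w b))\<bar> \<le> K * norm w ^ 2"
    using transported_form_remainder[OF \<Gamma> g flat, of x a b] by blast
  note T = bilinear_transported_form[OF \<Gamma> g, of x]
  show "((\<lambda>x. transported_form \<Gamma> g x a b) has_derivative
      (\<lambda>w. transported_form \<Gamma> g x (\<Gamma> w a) b + transported_form \<Gamma> g x a (\<Gamma> w b))) (at x)"
  proof (rule has_derivative_quadratic_remainder)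
    show "linear (\<lambda>w. transported_form \<Gamma> g x (\<Gamma> w a) b + transported_form \<Gamma> g x a (\<Gamma> w b))"
      by (auto intro!: linearI simp: bilinear_ladd[OF \<Gamma>] bilinear_lmul[OF \<Gamma>] bilinear_ladd[OF T]
          bilinear_radd[OF T] bilinear_lmul[OF T] bilinear_rmul[OF T] distrib_left)
  qed (use K in \<open>simp add: real_norm_def\<close>)
qed

section \<open>Parallel forms\<close>

lemma times_cont_diff_add:
  "times_cont_diff k f \<Longrightarrow> times_cont_diff k g \<Longrightarrow> times_cont_diff k (\<lambda>x. f x + g x)"
proof (induction k arbitrary: f g)
  case 0
  then show ?case by (simp add: continuous_on_add)
next
  case (Suc k)
  then have "((\<lambda>x. f x + g x) has_derivative
      (\<lambda>v. frechet_derivative f (at x) v + frechet_derivative g (at x) v)) (at x)" for x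
    by (intro has_derivative_add) (auto simp: frechet_derivative_works)
  from frechet_derivative_at[OF this, symmetric] Suc show ?case by simp
qed

lemma smooth_const: "smooth (\<lambda>x. c)"
proof -
  have "times_cont_diff k (\<lambda>x::'a. c)" for k and c :: 'b
    by (induction k arbitrary: c) auto
  then show ?thesis by (simp add: smooth_def)
qed

lemma smooth_imp_has_derivative:
  assumes "smooth f"
  shows "(f has_derivative frechet_derivative f (at x)) (at x)"
proof -
  have "times_cont_diff (Suc 0) f" using assms by (simp only: smooth_def)
  then show ?thesis by (simp add: frechet_derivative_works)
qed

text \<open>The induction is over all \<open>a\<close> and \<open>b\<close> at once: a directional derivative of one coefficient is the
  sum of two coefficients with other arguments.\<close>

lemma smooth_parallel_form:
  assumes "parallel_form \<Gamma> G"
  shows "smooth (\<lambda>x. G x a b)"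
proof -
  note deriv = assms[unfolded parallel_form_def, rule_format]
  have diff: "(\<lambda>x. G x a b) differentiable (at x)" for x a b
    using deriv unfolding differentiable_def by blast
  have frechet: "frechet_derivative (\<lambda>x. G x a b) (at x) w = G x (\<Gamma> w a) b + G x a (\<Gamma> w b)" for x a b w
    using frechet_derivative_at[OF deriv, of x a b] by metis
  have "times_cont_diff k (\<lambda>x. G x a b)" for k
  proof (induction k arbitrary: a b)
    case 0
    show ?case
      using differentiable_imp_continuous_within[OF diff] by (simp add: continuous_on_eq_continuous_within)
  next
    case (Suc k)
    then show ?case by (simp add: diff frechet times_cont_diff_add)
  qed
  then show ?thesis by (simp add: smooth_def)
qed

lemma torsion_free_connection_of:
  assumes "symmetric_map \<Gamma>"
  shows "torsion_free (connection_of \<Gamma>)"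
  using assms by (simp add: torsion_free_def connection_of_def lie_bracket_def symmetric_map_def)

lemma levi_civita_iff_parallel:
  fixes \<Gamma> :: "real ^ 'n \<Rightarrow> real ^ 'n \<Rightarrow> real ^ 'n"
  assumes \<Gamma>: "bilinear \<Gamma>" "symmetric_map \<Gamma>"
    and G: "\<And>x. bilinear (G x)" and smooth: "\<And>a b. smooth (\<lambda>x. G x a b)"
  shows "levi_civita_connection G (connection_of \<Gamma>) \<longleftrightarrow> parallel_form \<Gamma> G"
proof
  assume LC: "levi_civita_connection G (connection_of \<Gamma>)"
  show "parallel_form \<Gamma> G"
    unfolding parallel_form_def
  proof (intro allI)
    fix x a b
    have "frechet_derivative (\<lambda>x. G x a b) (at x) w = G x (\<Gamma> w a) b + G x a (\<Gamma> w b)" for w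
    proof -
      have "cov_deriv_form (connection_of \<Gamma>) G (\<lambda>_. w) (\<lambda>_. a) (\<lambda>_. b) x = 0"
        using LC smooth_const unfolding levi_civita_connection_def by blast
      then show ?thesis by (simp add: cov_deriv_form_def connection_of_def)
    qed
    then have "frechet_derivative (\<lambda>x. G x a b) (at x) = (\<lambda>w. G x (\<Gamma> w a) b + G x a (\<Gamma> w b))"
      by (rule ext)
    with smooth_imp_has_derivative[OF smooth, of a b x]
    show "((\<lambda>x. G x a b) has_derivative (\<lambda>w. G x (\<Gamma> w a) b + G x a (\<Gamma> w b))) (at x)" by simp
  qed
next
  assume parallel: "parallel_form \<Gamma> G"
  have "cov_deriv_form (connection_of \<Gamma>) G X Y Z x = 0"
    if "smooth X" "smooth Y" "smooth Z" for X Y Z :: "'n vfield" and x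
  proof -
    have "frechet_derivative (\<lambda>y. G y (Y y) (Z y)) (at x) =
       (\<lambda>h. (G x (\<Gamma> h (Y x)) (Z x) + G x (Y x) (\<Gamma> h (Z x)))
        + G x (Y x) (frechet_derivative Z (at x) h) + G x (frechet_derivative Y (at x) h) (Z x))"
      using has_derivative_bilinear_family[OF G parallel[unfolded parallel_form_def, rule_format]
          smooth_imp_has_derivative[OF that(2)] smooth_imp_has_derivative[OF that(3)], of x]
      by (rule frechet_derivative_at[symmetric])
    then show ?thesis
      by (simp add: cov_deriv_form_def connection_of_def bilinear_ladd[OF G] bilinear_radd[OF G])
  qed
  then show "levi_civita_connection G (connection_of \<Gamma>)"
    using torsion_free_connection_of[OF \<Gamma>(2)] unfolding levi_civita_connection_def by blast
qed

text \<open>A parallel form is constant on pairs of vector fields that are parallel along a ray, so it is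
  determined by its value at the origin.\<close>

lemma parallel_form_eq_transported_form:
  assumes \<Gamma>: "bilinear \<Gamma>" and G: "\<And>x. bilinear (G x)" and parallel: "parallel_form \<Gamma> G"
  shows "G v a b = transported_form \<Gamma> (G 0) v a b"
proof -
  note lin = linear_bilinear_right[OF \<Gamma>]
  define C where "C = (\<lambda>x. - \<Gamma> v x)"
  have C: "linear C" unfolding C_def by (rule linear_compose_neg[OF lin])
  define z where "z = (\<lambda>u s. operator_exp (\<lambda>x. s *\<^sub>R C x) u)"
  have z: "(z u has_derivative (\<lambda>h. h *\<^sub>R C (z u s))) (at s)" for u s
  proof -
    have "C (z u s) = operator_exp (\<lambda>x. s *\<^sub>R C x) (C u)"
      unfolding z_def
      by (rule operator_exp_commute[OF linear_compose_scale_right[OF C] C]) (rule linear_cmul[OF C])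
    then show ?thesis
      using has_vector_derivative_operator_exp[OF C, of u s]
      unfolding has_vector_derivative_def by (simp add: z_def)
  qed
  have ray: "((\<lambda>s. G (s *\<^sub>R v) u u') has_derivative
      (\<lambda>h. G (s *\<^sub>R v) (\<Gamma> (h *\<^sub>R v) u) u' + G (s *\<^sub>R v) u (\<Gamma> (h *\<^sub>R v) u'))) (at s)" for u u' s
    by (rule has_derivative_compose[OF _ parallel[unfolded parallel_form_def, rule_format]])
      (auto intro!: derivative_eq_intros)
  have const: "G (1 *\<^sub>R v) (z c 1) (z d 1) = G (0 *\<^sub>R v) (z c 0) (z d 0)" for c d
  proof -
    have "((\<lambda>s. G (s *\<^sub>R v) (z c s) (z d s)) has_derivative (\<lambda>h. 0)) (at s)" for s
      using has_derivative_bilinear_family[where G="\<lambda>s. G (s *\<^sub>R v)", OF G ray z[of c s] z[of d s]]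
      by (simp add: C_def bilinear_lmul[OF \<Gamma>] bilinear_lmul[OF G] bilinear_rmul[OF G]
          bilinear_lneg[OF G] bilinear_rneg[OF G])
    then show ?thesis by (intro zero_derivative_imp_constant)
  qed
  have "z (operator_exp (\<Gamma> v) u) 1 = u" for u
    using operator_exp_minus_cancel'[OF lin, of v u] by (simp add: z_def C_def)
  then show ?thesis
    using const[of "operator_exp (\<Gamma> v) a" "operator_exp (\<Gamma> v) b"]
    by (simp add: transported_form_def z_def operator_exp_zero)
qed

text \<open>The second derivative of \<open>\<lambda>x. G x a b\<close> in the directions \<open>w\<close> and \<open>v\<close> contains the mixed terms
  \<open>G (\<Gamma> w a) (\<Gamma> v b) + G (\<Gamma> v a) (\<Gamma> w b)\<close>, which are symmetric in \<open>v\<close> and \<open>w\<close>; equating the two orders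
  leaves the commutator terms.\<close>

lemma parallel_form_curvature:
  assumes \<Gamma>: "bilinear \<Gamma>" and G: "\<And>x. bilinear (G x)" and parallel: "parallel_form \<Gamma> G"
  shows "antisymmetric_wrt (G x) (commutator (\<Gamma> v) (\<Gamma> w))"
  unfolding antisymmetric_wrt_def
proof (intro allI)
  fix a b
  note deriv = parallel[unfolded parallel_form_def, rule_format]
  have second: "((\<lambda>y. G y (\<Gamma> u a) b + G y a (\<Gamma> u b)) has_derivative
     (\<lambda>h. (G x (\<Gamma> h (\<Gamma> u a)) b + G x (\<Gamma> u a) (\<Gamma> h b)) + (G x (\<Gamma> h a) (\<Gamma> u b) + G x a (\<Gamma> h (\<Gamma> u b)))))
     (at x)" for u
    by (intro has_derivative_add deriv)
  have "(G x (\<Gamma> v (\<Gamma> w a)) b + G x (\<Gamma> w a) (\<Gamma> v b)) + (G x (\<Gamma> v a) (\<Gamma> w b) + G x a (\<Gamma> v (\<Gamma> w b))) =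
      (G x (\<Gamma> w (\<Gamma> v a)) b + G x (\<Gamma> v a) (\<Gamma> w b)) + (G x (\<Gamma> w a) (\<Gamma> v b) + G x a (\<Gamma> w (\<Gamma> v b)))"
    by (rule symmetric_second_derivatives[OF deriv refl refl second second])
  then show "G x (commutator (\<Gamma> v) (\<Gamma> w) a) b + G x a (commutator (\<Gamma> v) (\<Gamma> w) b) = 0"
    by (simp add: commutator_def bilinear_lsub[OF G] bilinear_rsub[OF G])
qed

section \<open>The metrics with a given Levi-Civita connection\<close>

theorem lemma3p1:
  fixes \<Gamma> :: "real ^ 'n \<Rightarrow> real ^ 'n \<Rightarrow> real ^ 'n"
    and g\<^sub>0 :: "real ^ 'n \<Rightarrow> real ^ 'n \<Rightarrow> real"
  assumes "bilinear \<Gamma>" and "symmetric_map \<Gamma>"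
    and "bilinear g\<^sub>0" and "symmetric_map g\<^sub>0" and "nondegenerate_form g\<^sub>0"
  shows "(\<exists>g. semi_riemannian_metric g \<and> g 0 = g\<^sub>0 \<and>
              levi_civita_connection g (connection_of \<Gamma>)) \<longleftrightarrow>
         (\<forall>v w\<^sub>1 w\<^sub>2. antisymmetric_wrt g\<^sub>0
            (operator_exp (\<Gamma> v) \<circ> commutator (\<Gamma> w\<^sub>1) (\<Gamma> w\<^sub>2) \<circ> operator_exp (\<lambda>x. - \<Gamma> v x)))"
proof
  note lin = linear_bilinear_right[OF assms(1)]
  assume "\<exists>g. semi_riemannian_metric g \<and> g 0 = g\<^sub>0 \<and> levi_civita_connection g (connection_of \<Gamma>)"
  then obtain g where g: "semi_riemannian_metric g" and g0: "g 0 = g\<^sub>0"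
    and LC: "levi_civita_connection g (connection_of \<Gamma>)" by blast
  have bil: "bilinear (g x)" for x using g by (simp add: semi_riemannian_metric_def)
  have parallel: "parallel_form \<Gamma> g"
    using levi_civita_iff_parallel[OF assms(1,2) bil] g LC
    by (simp add: semi_riemannian_metric_def)
  show "\<forall>v w\<^sub>1 w\<^sub>2. antisymmetric_wrt g\<^sub>0
      (operator_exp (\<Gamma> v) \<circ> commutator (\<Gamma> w\<^sub>1) (\<Gamma> w\<^sub>2) \<circ> operator_exp (\<lambda>x. - \<Gamma> v x))"
    unfolding antisymmetric_wrt_def
  proof (intro allI)
    fix v w\<^sub>1 w\<^sub>2 \<xi> \<eta>
    let ?C = "commutator (\<Gamma> w\<^sub>1) (\<Gamma> w\<^sub>2)" and ?E = "operator_exp (\<Gamma> v)"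
      and ?F = "operator_exp (\<lambda>x. - \<Gamma> v x)"
    have "g v (?C (?F \<xi>)) (?F \<eta>) + g v (?F \<xi>) (?C (?F \<eta>)) = 0"
      using parallel_form_curvature[OF assms(1) bil parallel] by (simp add: antisymmetric_wrt_def)
    then show "g\<^sub>0 ((?E \<circ> ?C \<circ> ?F) \<xi>) \<eta> + g\<^sub>0 \<xi> ((?E \<circ> ?C \<circ> ?F) \<eta>) = 0"
      by (simp add: parallel_form_eq_transported_form[OF assms(1) bil parallel, of v]
          transported_form_def g0 operator_exp_minus_cancel[OF lin])
  qed
next
  note lin = linear_bilinear_right[OF assms(1)]
  assume flat: "\<forall>v w\<^sub>1 w\<^sub>2. antisymmetric_wrt g\<^sub>0
      (operator_exp (\<Gamma> v) \<circ> commutator (\<Gamma> w\<^sub>1) (\<Gamma> w\<^sub>2) \<circ> operator_exp (\<lambda>x. - \<Gamma> v x))"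
  let ?g = "transported_form \<Gamma> g\<^sub>0"
  have parallel: "parallel_form \<Gamma> ?g"
    using flat by (intro parallel_transported_form assms) blast
  have bil: "bilinear (?g x)" for x by (intro bilinear_transported_form assms)
  have "nondegenerate_form (?g x)" for x
    unfolding nondegenerate_form_def
  proof (intro allI impI)
    fix u assume "\<forall>v. ?g x u v = 0"
    then have "g\<^sub>0 (operator_exp (\<Gamma> x) u) v = 0" for v
      unfolding transported_form_def by (metis operator_exp_minus_cancel[OF lin])
    then have "operator_exp (\<Gamma> x) u = 0"
      using assms(5) unfolding nondegenerate_form_def by blast
    then show "u = 0"
      using operator_exp_minus_cancel'[OF lin, of x u]
        linear_0[OF linear_operator_exp[OF linear_compose_neg[OF lin]]] by simp
  qed
  moreover have "symmetric_map (?g x)" for x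
    using assms(4) by (simp add: symmetric_map_def transported_form_def)
  ultimately have "semi_riemannian_metric ?g"
    using bil smooth_parallel_form[OF parallel] by (simp add: semi_riemannian_metric_def)
  moreover have "?g 0 = g\<^sub>0"
  proof -
    have zero: "\<Gamma> 0 = (\<lambda>x. 0)" by (rule ext) (rule bilinear_lzero[OF assms(1)])
    show ?thesis by (intro ext) (simp only: transported_form_def zero operator_exp_zero)
  qed
  moreover have "levi_civita_connection ?g (connection_of \<Gamma>)"
    using levi_civita_iff_parallel[OF assms(1,2) bil smooth_parallel_form[OF parallel]] parallel by blast
  ultimately show "\<exists>g. semi_riemannian_metric g \<and> g 0 = g\<^sub>0 \<and>
      levi_civita_connection g (connection_of \<Gamma>)" by blast
qed

end
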